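(* Assume the gradients $\nabla f_1,\ldots,\nabla f_m$ are Lipschitz continuous with constants $L_1,\ldots,L_m$ (let $L_{\max}=\max_{j=1,\ldots,m}L_j$), and that there exists a nonempty subset $J\subseteq\{1,\ldots,m\}$ such that $f_j$ is bounded below for all $j\in J$. Let $\{X^k\}$ be the sequence of sets of nondominated points produced by the Front Descent algorithm (described in the context) with $\sigma_k=0$ for all $k$, and let $\{x_{j_k}\}$ be a refining linked sequence. Let $\bar k$ be the first iteration index such that $x_{j_k}=z_{j_{k-1}}^{k-1}$ for all $k>\bar k$. Then, for any $\epsilon>0$, after at most $k_{\max}$ iterations we get $\|v(x_{j_{k_{\max}}})\|\le\epsilon$, with $k_{\max}=\bar k+k_{\mathrm{ref}}$ and $k_{\mathrm{ref}}=\mathcal{O}\left(\frac1{\epsilon^2}\right)$.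
   Context: Setting. $F=(f_1,\ldots,f_m)^\top:\mathbb{R}^n\to\mathbb{R}^m$ is continuously differentiable. For $u,w\in\mathbb{R}^m$: $u\le w$ means $u_i\le w_i$ for all $i$; $u<w$ means $u_i<w_i$ for all $i$; $u\lneqq w$ means $u\le w$ and $u\ne w$. A point $y$ is dominated by $x$ if $F(x)\lneqq F(y)$. A set of points is mutually nondominated if none of its points is dominated by another one. $\mathbf{1}\in\mathbb{R}^m$ is the all-ones vector. For $x,d\in\mathbb{R}^n$ let $\mathcal{D}(x,d)=\max_{j=1,\ldots,m}\nabla f_j(x)^\top d$. For nonempty $I\subseteq\{1,\ldots,m\}$ let $\theta^I(x)=\min_{d\in\mathbb{R}^n}\max_{j\in I}\nabla f_j(x)^\top d+\frac12\|d\|^2$ and let $v^I(x)$ be the unique minimizer; $\theta$ and $v$ denote $\theta^I$ and $v^I$ for $I=\{1,\ldots,m\}$. A common descent direction at $x$ is a direction that is a descent direction at $x$ for every $f_j$. Front Descent algorithm. Input: a nonempty finite set $X^0$ of mutually nondominated points; $\alpha_0>0$, $\delta\in(0,1)$, $\gamma\in(0,1)$, $\Gamma_1>0$, $\Gamma_2>0$, a sequence $\{\sigma_k\}\subseteq\mathbb{R}_+$ (nonnegative reals). The algorithm is run without stopping, producing an infinite sequence $\{X^k\}$. At iteration $k=0,1,\ldots$: set $\hat X^k=X^k$; then, sequentially for all $x_c\in X^k$, if $x_c\in\hat X^k$ at that moment, process $x_c$ as follows. (1) Refinement. If $\theta(x_c)<-\sigma_k$: compute a common descent direction $v_D(x_c)$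 (arbitrary); if both $\mathcal{D}(x_c,v_D(x_c))\le-\Gamma_1\|v(x_c)\|^2$ and $\|v_D(x_c)\|\le\Gamma_2\|v(x_c)\|$, set $d_c=v_D(x_c)$, otherwise set $d_c=v(x_c)$; set $\alpha_c^k=\max_{h\in\mathbb{N}}\{\alpha_0\delta^h\mid F(x_c+\alpha_0\delta^hd_c)\le F(x_c)+\mathbf{1}\gamma\alpha_0\delta^h\mathcal{D}(x_c,d_c)\}$. Otherwise (if $\theta(x_c)\ge-\sigma_k$) set $d_c=v(x_c)$, $\alpha_c^k=0$. In both cases set $z_c^k=x_c+\alpha_c^kd_c$ and update $\hat X^k\leftarrow\hat X^k\setminus\{y\in\hat X^k\mid F(z_c^k)\lneqq F(y)\}\cup\{z_c^k\}$. (2) Exploration. For every nonempty proper subset $I\subsetneq\{1,\ldots,m\}$ with $\theta^I(z_c^k)<0$: if $z_c^k\in\hat X^k$ at that moment, set $\alpha_c^I=\max_{h\in\mathbb{N}}\{\alpha_0\delta^h\mid\forall y\in\hat X^k\ \exists j:\ f_j(z_c^k+\alpha_0\delta^hv^I(z_c^k))<f_j(y)\}$, let $w=z_c^k+\alpha_c^Iv^I(z_c^k)$ and update $\hat X^k\leftarrow\hat X^k\setminus\{y\in\hat X^k\mid F(w)\lneqq F(y)\}\cup\{w\}$. After all points have been considered, set $X^{k+1}=\hat X^k$. Linked sequence. A sequence $\{x_{j_k}\}$ such that, for every $k=1,2,\ldots$, the point $x_{j_k}\in X^k$ is generated at iteration $k-1$ of the algorithm (as the refinement point $z$ or as one of the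 exploration points $w$) while processing the point $x_{j_{k-1}}\in X^{k-1}$. It is a refining linked sequence if there exists $\bar k$ such that, for all $k>\bar k$, $x_{j_k}=z_{j_{k-1}}^{k-1}$, where $z_{j_{k-1}}^{k-1}$ is the refinement point obtained at iteration $k-1$ when processing $x_{j_{k-1}}$. The $\mathcal{O}(1/\epsilon^2)$ refers to dependence on $\epsilon$: the hidden constant does not depend on $\epsilon$. *)

theory Defs
  imports "HOL-Analysis.Analysis"
begin

section \<open>Vector optimization\<close>

definition nabla :: "(real^'n \<Rightarrow> real^'m) \<Rightarrow> 'm \<Rightarrow> real^'n \<Rightarrow> real^'n" where
  "nabla F j x = (THE D. GDERIV (\<lambda>y. F y $ j) x :> D)"

definition continuously_differentiable :: "(real^'n \<Rightarrow> real^'m) \<Rightarrow> bool" where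
  "continuously_differentiable F \<longleftrightarrow>
     F differentiable_on UNIV \<and> (\<forall>j. continuous_on UNIV (nabla F j))"

definition dominates :: "(real^'n \<Rightarrow> real^'m) \<Rightarrow> real^'n \<Rightarrow> real^'n \<Rightarrow> bool" where
  "dominates F x y \<longleftrightarrow> F x \<le> F y \<and> F x \<noteq> F y"

definition mutually_nondominated :: "(real^'n \<Rightarrow> real^'m) \<Rightarrow> (real^'n) set \<Rightarrow> bool" where
  "mutually_nondominated F S \<longleftrightarrow> (\<forall>x\<in>S. \<forall>y\<in>S. \<not> dominates F x y)"

definition max_slope :: "(real^'n \<Rightarrow> real^'m) \<Rightarrow> real^'n \<Rightarrow> real^'n \<Rightarrow> real" where
  "max_slope F x d = (MAX j. nabla F j x \<bullet> d)"

definition common_descent_direction ::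
  "(real^'n \<Rightarrow> real^'m) \<Rightarrow> real^'n \<Rightarrow> real^'n \<Rightarrow> bool" where
  "common_descent_direction F x d \<longleftrightarrow> (\<forall>j. nabla F j x \<bullet> d < 0)"

definition steepest_objective ::
  "(real^'n \<Rightarrow> real^'m) \<Rightarrow> 'm set \<Rightarrow> real^'n \<Rightarrow> real^'n \<Rightarrow> real" where
  "steepest_objective F I x d = (MAX j\<in>I. nabla F j x \<bullet> d) + 1 / 2 * (norm d)^2"

text \<open>
  For nonempty \<open>I\<close> the objective is continuous, strongly convex and coercive in \<open>d\<close>, so that
  the infimum in \<open>theta\<close> is a minimum and the minimizer selected by \<open>steepest_direction\<close>
  exists and is unique. The unrestricted functions of the full problem are the instances
  \<open>I = UNIV\<close>.
\<close>

definition theta :: "(real^'n \<Rightarrow> real^'m) \<Rightarrow> 'm set \<Rightarrow> real^'n \<Rightarrow> real" where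
  "theta F I x = (INF d. steepest_objective F I x d)"

definition steepest_direction ::
  "(real^'n \<Rightarrow> real^'m) \<Rightarrow> 'm set \<Rightarrow> real^'n \<Rightarrow> real^'n" where
  "steepest_direction F I x =
     (THE d. \<forall>d'. steepest_objective F I x d \<le> steepest_objective F I x d')"


section \<open>The Front Descent algorithm\<close>

record fd_params =
  alpha0 :: real
  delta :: real
  gamma :: real
  Gamma1 :: real
  Gamma2 :: real
  sigma :: "nat \<Rightarrow> real"

definition valid_params :: "fd_params \<Rightarrow> bool" where
  "valid_params P \<longleftrightarrow>
     0 < alpha0 P \<and> 0 < delta P \<and> delta P < 1 \<and> 0 < gamma P \<and> gamma P < 1 \<and>
     0 < Gamma1 P \<and> 0 < Gamma2 P \<and> (\<forall>k. 0 \<le> sigma P k)"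

definition is_maximum :: "real set \<Rightarrow> real \<Rightarrow> bool" where
  "is_maximum A a \<longleftrightarrow> a \<in> A \<and> (\<forall>b\<in>A. b \<le> a)"

definition insert_point ::
  "(real^'n \<Rightarrow> real^'m) \<Rightarrow> real^'n \<Rightarrow> (real^'n) set \<Rightarrow> (real^'n) set" where
  "insert_point F z S = (S - {y \<in> S. dominates F z y}) \<union> {z}"

text \<open>
  The algorithm is nondeterministic (choice of \<open>vD\<close>, order in which points and index sets are
  visited), so every step is a relation between its input and its possible outcomes.
  In \<open>refinement\<close>, the \<open>1\<close> in the sufficient decrease condition is the all-ones vector.
\<close>

definition refinement ::
  "fd_params \<Rightarrow> (real^'n \<Rightarrow> real^'m) \<Rightarrow> nat \<Rightarrow> real^'n \<Rightarrow> real^'n \<Rightarrow> bool" where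
  "refinement P F k x z \<longleftrightarrow>
     (\<exists>d a.
        (if theta F UNIV x < - sigma P k
         then (\<exists>vD. common_descent_direction F x vD \<and>
                 d = (if max_slope F x vD \<le> - Gamma1 P * (norm (steepest_direction F UNIV x))^2 \<and>
                         norm vD \<le> Gamma2 P * norm (steepest_direction F UNIV x)
                      then vD else steepest_direction F UNIV x)) \<and>
              is_maximum {alpha0 P * delta P ^ h |h.
                 F (x + (alpha0 P * delta P ^ h) *\<^sub>R d)
                   \<le> F x + (gamma P * (alpha0 P * delta P ^ h) * max_slope F x d) *\<^sub>R 1} a
         else d = steepest_direction F UNIV x \<and> a = 0) \<and>
        z = x + a *\<^sub>R d)"

text \<open>
  \<open>exploration P F z Is S S' W\<close>: visiting the index sets in the list \<open>Is\<close> in order, starting from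
  the current set \<open>S\<close>, can end in the set \<open>S'\<close>, the points inserted on the way forming the set \<open>W\<close>.
\<close>

inductive exploration ::
  "fd_params \<Rightarrow> (real^'n \<Rightarrow> real^'m) \<Rightarrow> real^'n \<Rightarrow> 'm set list \<Rightarrow>
     (real^'n) set \<Rightarrow> (real^'n) set \<Rightarrow> (real^'n) set \<Rightarrow> bool"
  for P F z where
  finished: "exploration P F z [] S S {}"
| skipped: "\<lbrakk>z \<notin> S; exploration P F z Is S S' W\<rbrakk> \<Longrightarrow> exploration P F z (I # Is) S S' W"
| explored: "\<lbrakk>z \<in> S;
    is_maximum {alpha0 P * delta P ^ h |h. \<forall>y\<in>S. \<exists>j.
      F (z + (alpha0 P * delta P ^ h) *\<^sub>R steepest_direction F I z) $ j < F y $ j} a;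
    w = z + a *\<^sub>R steepest_direction F I z;
    exploration P F z Is (insert_point F w S) S' W\<rbrakk>
    \<Longrightarrow> exploration P F z (I # Is) S S' (insert w W)"

type_synonym 'n processing_log = "((real^'n) \<times> (real^'n) \<times> (real^'n) set) set"

text \<open>
  \<open>sweep P F k xs S S' R\<close>: in iteration \<open>k\<close>, considering the points in the list \<open>xs\<close> in order,
  starting from the current set \<open>S\<close>, can end in the set \<open>S'\<close>. The set \<open>R\<close> records, for every
  point \<open>x\<close> that was actually processed, the triple \<open>(x, z, W)\<close> of \<open>x\<close>, its refinement point \<open>z\<close>
  and the set \<open>W\<close> of the exploration points generated from it.
\<close>

inductive sweep ::
  "fd_params \<Rightarrow> (real^'n \<Rightarrow> real^'m) \<Rightarrow> nat \<Rightarrow> (real^'n) list \<Rightarrow>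
     (real^'n) set \<Rightarrow> (real^'n) set \<Rightarrow> 'n processing_log \<Rightarrow> bool"
  for P F k where
  finished: "sweep P F k [] S S {}"
| skipped: "\<lbrakk>x \<notin> S; sweep P F k xs S S' R\<rbrakk> \<Longrightarrow> sweep P F k (x # xs) S S' R"
| processed: "\<lbrakk>x \<in> S; refinement P F k x z;
    distinct Is; set Is = {I. I \<noteq> {} \<and> I \<subset> UNIV \<and> theta F I z < 0};
    exploration P F z Is (insert_point F z S) S'' W;
    sweep P F k xs S'' S' R\<rbrakk>
    \<Longrightarrow> sweep P F k (x # xs) S S' (insert (x, z, W) R)"

definition front_descent_run ::
  "fd_params \<Rightarrow> (real^'n \<Rightarrow> real^'m) \<Rightarrow> (real^'n) set \<Rightarrow> (nat \<Rightarrow> (real^'n) set) \<Rightarrow>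
     (nat \<Rightarrow> 'n processing_log) \<Rightarrow> bool" where
  "front_descent_run P F X0 X R \<longleftrightarrow>
     valid_params P \<and> finite X0 \<and> X0 \<noteq> {} \<and> mutually_nondominated F X0 \<and>
     X 0 = X0 \<and>
     (\<forall>k. \<exists>xs. distinct xs \<and> set xs = X k \<and> sweep P F k xs (X k) (X (Suc k)) (R k))"


section \<open>Linked sequences\<close>

definition linked_sequence ::
  "(nat \<Rightarrow> (real^'n) set) \<Rightarrow> (nat \<Rightarrow> 'n processing_log) \<Rightarrow>
     (nat \<Rightarrow> real^'n) \<Rightarrow> bool" where
  "linked_sequence X R x \<longleftrightarrow>
     (\<forall>k\<ge>1. x (k - 1) \<in> X (k - 1) \<and> x k \<in> X k \<and>
        (\<exists>z W. (x (k - 1), z, W) \<in> R (k - 1) \<and> (x k = z \<or> x k \<in> W)))"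

definition refining_after ::
  "(nat \<Rightarrow> 'n processing_log) \<Rightarrow> (nat \<Rightarrow> real^'n) \<Rightarrow> nat \<Rightarrow> bool" where
  "refining_after R x K \<longleftrightarrow> (\<forall>k>K. \<exists>z W. (x (k - 1), z, W) \<in> R (k - 1) \<and> x k = z)"

definition refining_linked_sequence ::
  "(nat \<Rightarrow> (real^'n) set) \<Rightarrow> (nat \<Rightarrow> 'n processing_log) \<Rightarrow>
     (nat \<Rightarrow> real^'n) \<Rightarrow> bool" where
  "refining_linked_sequence X R x \<longleftrightarrow> linked_sequence X R x \<and> (\<exists>K. refining_after R x K)"

end

theory Submission
  imports Defs
begin

text \<open>
  The minimality of \<open>v(x)\<close> gives \<open>\<D>(x, v(x)) \<le> - \<parallel>v(x)\<parallel>\<^sup>2\<close>, so every direction \<open>d\<close> used in a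
  refinement step satisfies \<open>\<D>(x, d) \<le> - c \<parallel>v(x)\<parallel>\<^sup>2\<close> and \<open>\<parallel>d\<parallel>\<^sup>2 \<le> - q \<D>(x, d)\<close> with
  constants \<open>c, q > 0\<close>. By the descent lemma, backtracking then accepts any step below
  \<open>2 (1 - \<gamma>) / (L q)\<close>, so step sizes stay above some \<open>\<alpha>\<close> and each refinement lowers every
  \<open>f\<^sub>j\<close> by at least \<open>\<gamma> \<alpha> c \<parallel>v(x)\<parallel>\<^sup>2\<close>. Since some \<open>f\<^sub>j\<close> is bounded below, at most
  \<open>C / \<epsilon>\<^sup>2\<close> refinements can start from a point with \<open>\<parallel>v(x)\<parallel> > \<epsilon>\<close>.
\<close>

section \<open>Gradients and the descent lemma\<close>

text \<open>\<open>nabla\<close> is a definite description, so a gradient must be shown to exist and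
  to be unique. The derivative of a component is a linear functional and is represented by the
  adjoint applied to \<open>1\<close>; uniqueness is inherited from the Frechet derivative.\<close>

lemma nabla_gderiv:
  fixes F :: "real^'n \<Rightarrow> real^'m"
  assumes "F differentiable_on UNIV"
  shows "GDERIV (\<lambda>y. F y $ j) x :> nabla F j x"
proof -
  obtain F' where F': "(F has_derivative F') (at x)"
    using assms by (auto simp: differentiable_on_def differentiable_def)
  then have der: "((\<lambda>y. F y $ j) has_derivative (\<lambda>h. F' h $ j)) (at x)"
    by (rule bounded_linear.has_derivative[OF bounded_linear_vec_nth])
  then have lin: "linear (\<lambda>h. F' h $ j)"
    by (rule has_derivative_linear)
  define G where "G = adjoint (\<lambda>h. F' h $ j) 1"
  have "(\<lambda>h. F' h $ j) = (\<lambda>h. h \<bullet> G)"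
    using adjoint_works[OF lin, of _ 1] by (simp add: G_def fun_eq_iff)
  with der have G: "GDERIV (\<lambda>y. F y $ j) x :> G"
    by (simp add: gderiv_def)
  have unique: "D = G" if "GDERIV (\<lambda>y. F y $ j) x :> D" for D
  proof -
    have "(\<lambda>h. h \<bullet> D) = (\<lambda>h. h \<bullet> G)"
      using that G unfolding gderiv_def by (rule has_derivative_unique)
    then show ?thesis
      using vector_eq_ldot[of D G] by (simp add: fun_eq_iff)
  qed
  have "nabla F j x = G"
    unfolding nabla_def by (rule the_equality; fact G unique)
  with G show ?thesis
    by simp
qed

text \<open>Along the segment, \<open>h\<close> is \<open>f\<close> minus its linear model and the
  quadratic bound. Cauchy-Schwarz and the Lipschitz condition make its derivative nonpositive for
  \<open>t \<ge> 0\<close>, and comparing \<open>h 1\<close> with \<open>h 0\<close> is the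
  claim.\<close>

lemma descent_lemma:
  fixes f :: "'a::real_inner \<Rightarrow> real"
  assumes grad: "\<And>y. GDERIV f y :> g y" and lip: "L-lipschitz_on UNIV g"
  shows "f (x + d) \<le> f x + g x \<bullet> d + L / 2 * (norm d)^2"
proof -
  define h where "h t = f (x + t *\<^sub>R d) - t * (g x \<bullet> d) - L / 2 * t^2 * (norm d)^2" for t
  have nonincreasing: "\<exists>y. DERIV h t :> y \<and> y \<le> 0" if "0 \<le> t" for t
  proof (intro exI conjI)
    have "((\<lambda>t. f (x + t *\<^sub>R d)) has_derivative (\<lambda>s. (s *\<^sub>R d) \<bullet> g (x + t *\<^sub>R d))) (at t)"
      by (rule has_derivative_compose[of "\<lambda>t. x + t *\<^sub>R d" _ _ _ f])
        (use grad in \<open>auto simp: gderiv_def intro!: derivative_eq_intros\<close>)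
    then have "((\<lambda>t. f (x + t *\<^sub>R d)) has_field_derivative (g (x + t *\<^sub>R d) \<bullet> d)) (at t)"
      by (simp add: has_field_derivative_def inner_commute mult.commute[of _ "_ \<bullet> _"])
    then show "DERIV h t :> g (x + t *\<^sub>R d) \<bullet> d - g x \<bullet> d - L * t * (norm d)^2"
      unfolding h_def by (auto intro!: derivative_eq_intros)
    have "(g (x + t *\<^sub>R d) - g x) \<bullet> d \<le> norm (g (x + t *\<^sub>R d) - g x) * norm d"
      by (rule norm_cauchy_schwarz)
    also have "\<dots> \<le> (L * (t * norm d)) * norm d"
      using lipschitz_onD[OF lip, of "x + t *\<^sub>R d" x] \<open>0 \<le> t\<close>
      by (intro mult_right_mono) (auto simp: dist_norm)
    finally show "g (x + t *\<^sub>R d) \<bullet> d - g x \<bullet> d - L * t * (norm d)^2 \<le> 0"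
      by (simp add: inner_diff_left power2_eq_square mult.assoc)
  qed
  have "h 1 \<le> h 0"
    by (rule DERIV_nonpos_imp_nonincreasing[OF zero_le_one nonincreasing])
  then show ?thesis
    by (simp add: h_def)
qed

section \<open>The steepest common descent direction\<close>

lemma steepest_objective_attains_inf:
  assumes "I \<noteq> {}"
  shows "\<exists>d. \<forall>d'. steepest_objective F I x d \<le> steepest_objective F I x d'"
proof -
  obtain i where i: "i \<in> I"
    using assms by blast
  \<comment> \<open>Beyond this radius half the squared norm outweighs the slope of the single
    objective \<open>i\<close>, so the value is at least \<open>0\<close>, the value at the origin.
    A minimizer over the compact ball is therefore global.\<close>
  define r where "r = 2 * norm (nabla F i x)"
  have "continuous_on S (\<lambda>d. MAX j\<in>I. nabla F j x \<bullet> d)" for S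
    using finite[of I] assms
  proof (induction I rule: finite_ne_induct)
    case (insert j I)
    then show ?case
      by (auto simp: intro!: continuous_intros)
  qed (auto intro!: continuous_intros)
  then have "continuous_on (cball 0 r) (steepest_objective F I x)"
    unfolding steepest_objective_def by (auto intro!: continuous_intros)
  then obtain d where d: "\<And>d'. d' \<in> cball 0 r \<Longrightarrow>
      steepest_objective F I x d \<le> steepest_objective F I x d'"
    using continuous_attains_inf[of "cball 0 r" "steepest_objective F I x"]
    by (force simp: r_def)
  have at_0: "steepest_objective F I x 0 = 0"
    using assms by (simp add: steepest_objective_def image_constant_conv)
  have "steepest_objective F I x d \<le> steepest_objective F I x d'" for d'
  proof (cases "d' \<in> cball 0 r")
    case False
    then have "norm (nabla F i x) * norm d' \<le> 1 / 2 * norm d' * norm d'"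
      by (intro mult_right_mono) (auto simp: r_def)
    moreover have "- (nabla F i x \<bullet> d') \<le> norm (nabla F i x) * norm d'"
      using Cauchy_Schwarz_ineq2[of "nabla F i x" d'] by linarith
    moreover have "nabla F i x \<bullet> d' \<le> (MAX j\<in>I. nabla F j x \<bullet> d')"
      using i by (intro Max_ge) auto
    ultimately have "0 \<le> steepest_objective F I x d'"
      by (simp add: steepest_objective_def power2_eq_square)
    moreover have "steepest_objective F I x d \<le> 0"
      using d[of 0] at_0 by (simp add: r_def)
    ultimately show ?thesis
      by linarith
  qed (rule d)
  then show ?thesis
    by blast
qed

text \<open>Strong convexity in midpoint form: the maximum of linear functions is convex, and the
  parallelogram law supplies the quadratic gain. It serves to show that the minimizer is
  unique.\<close>

lemma steepest_objective_midpoint: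
  assumes "I \<noteq> {}"
  shows "2 * steepest_objective F I x (midpoint d e) + (norm (d - e))^2 / 4 \<le>
    steepest_objective F I x d + steepest_objective F I x e"
proof -
  have le: "nabla F j x \<bullet> u \<le> (MAX j\<in>I. nabla F j x \<bullet> u)" if "j \<in> I" for j u
    using that by (intro Max_ge) auto
  have "(MAX j\<in>I. nabla F j x \<bullet> midpoint d e) \<le>
      ((MAX j\<in>I. nabla F j x \<bullet> d) + (MAX j\<in>I. nabla F j x \<bullet> e)) / 2"
    using assms by (subst Max_le_iff)
      (auto simp: midpoint_def inner_add_right field_simps intro!: add_mono le)
  moreover have "(norm (midpoint d e))^2 = ((norm d)^2 + (norm e)^2) / 2 - (norm (d - e))^2 / 4"
    unfolding midpoint_def power2_norm_eq_inner
    by (simp add: inner_add_left inner_add_right inner_diff_left inner_diff_right inner_commute[of e d] field_simps)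
  ultimately show ?thesis
    by (simp add: steepest_objective_def field_simps)
qed

lemma steepest_direction_minimal:
  assumes "I \<noteq> {}"
  shows "steepest_objective F I x (steepest_direction F I x) \<le> steepest_objective F I x d"
proof -
  have unique: "d = e"
    if "\<forall>d'. steepest_objective F I x d \<le> steepest_objective F I x d'"
      and "\<forall>d'. steepest_objective F I x e \<le> steepest_objective F I x d'" for d e
  proof -
    \<comment> \<open>The midpoint of two minimizers cannot have a smaller value than either, which
      leaves no room for the quadratic gain.\<close>
    have "(norm (d - e))^2 \<le> 0"
      using steepest_objective_midpoint[OF assms, of F x d e] that(1)[rule_format, of "midpoint d e"]
        that(2)[rule_format, of "midpoint d e"] by linarith
    then show ?thesis
      by simp
  qed
  obtain d\<^sub>0 where d\<^sub>0: "\<forall>d'. steepest_objective F I x d\<^sub>0 \<le> steepest_objective F I x d'"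
    using steepest_objective_attains_inf[OF assms] by blast
  have "\<forall>d'. steepest_objective F I x (steepest_direction F I x) \<le> steepest_objective F I x d'"
    unfolding steepest_direction_def using d\<^sub>0 by (rule theI) (rule unique[OF _ d\<^sub>0])
  then show ?thesis
    by blast
qed

lemma Max_slope_scaleR:
  assumes "I \<noteq> {}" "0 \<le> t"
  shows "(MAX j\<in>I. nabla F j x \<bullet> (t *\<^sub>R d)) = t * (MAX j\<in>I. nabla F j x \<bullet> d)"
proof -
  have "mono ((*) t)"
    using \<open>0 \<le> t\<close> by (simp add: mono_def mult_left_mono)
  then show ?thesis
    using mono_Max_commute[of "(*) t" "(\<lambda>j. nabla F j x \<bullet> d) ` I"] assms
    by (simp add: image_image)
qed

text \<open>The minimizer \<open>v\<close> is compared with its shrunken copies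
  \<open>t *\<^sub>R v\<close>, on which the maximal slope is homogeneous. Plain comparison with
  \<open>0\<close> would lose a factor 2 in the bound.\<close>

lemma Max_slope_steepest_direction:
  assumes "I \<noteq> {}"
  shows "(MAX j\<in>I. nabla F j x \<bullet> steepest_direction F I x) \<le> - ((norm (steepest_direction F I x))^2)"
proof -
  define v where "v = steepest_direction F I x"
  define M where "M = (MAX j\<in>I. nabla F j x \<bullet> v)"
  have "M + (1 + t) / 2 * (norm v)^2 \<le> 0" if "0 < t" "t < 1" for t
  proof -
    have "M + 1 / 2 * (norm v)^2 \<le> t * M + 1 / 2 * (t * norm v)^2"
      using steepest_direction_minimal[OF assms, of F x "t *\<^sub>R v"] Max_slope_scaleR[OF assms, of t F x v]
        that by (simp add: steepest_objective_def v_def M_def)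
    \<comment> \<open>The difference of the two objective values has the positive factor
      \<open>1 - t\<close>; once this is cancelled, letting \<open>t\<close> tend to 1 from the left
      gives the full bound.\<close>
    moreover have "(1 - t) * (M + (1 + t) / 2 * (norm v)^2) =
        M + 1 / 2 * (norm v)^2 - (t * M + 1 / 2 * (t * norm v)^2)"
      by (simp add: field_simps power2_eq_square)
    ultimately have "(1 - t) * (M + (1 + t) / 2 * (norm v)^2) \<le> 0"
      by simp
    then show ?thesis
      using that by (simp add: mult_le_0_iff)
  qed
  then have "\<forall>\<^sub>F t in at_left 1. M + (1 + t) / 2 * (norm v)^2 \<le> 0"
    by (auto simp: eventually_at_left_field intro!: exI[of _ 0])
  moreover have "((\<lambda>t. M + (1 + t) / 2 * (norm v)^2) \<longlongrightarrow> M + (1 + 1) / 2 * (norm v)^2) (at_left 1)"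
    by (intro tendsto_intros) simp
  ultimately have "M + (1 + 1) / 2 * (norm v)^2 \<le> 0"
    by (intro tendsto_upperbound) auto
  then show ?thesis
    by (simp add: M_def v_def)
qed

text \<open>Translates the test of the algorithm into a statement on the direction: a nonnegative
  \<open>theta\<close> forces the steepest direction to vanish.\<close>

lemma theta_le:
  assumes "I \<noteq> {}"
  shows "theta F I x \<le> - ((norm (steepest_direction F I x))^2) / 2"
proof -
  have "theta F I x \<le> steepest_objective F I x (steepest_direction F I x)"
    unfolding theta_def
    by (rule cINF_lower) (auto intro!: bdd_belowI2 steepest_direction_minimal[OF assms])
  also have "\<dots> \<le> - ((norm (steepest_direction F I x))^2) / 2"
    using Max_slope_steepest_direction[OF assms, of F x] by (simp add: steepest_objective_def)
  finally show ?thesis .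
qed

section \<open>Sufficient decrease of refinement steps\<close>

lemma nabla_le_max_slope: "nabla F j x \<bullet> d \<le> max_slope F x d"
  unfolding max_slope_def by (rule Max_ge) auto

lemma armijo_condition:
  fixes F :: "real^'n \<Rightarrow> real^'m"
  assumes "F differentiable_on UNIV" "\<And>j. K-lipschitz_on UNIV (nabla F j)"
    and "(norm d)^2 \<le> - q * max_slope F x d" "max_slope F x d \<le> 0"
    and "0 \<le> a" "K * q * a \<le> 2 * (1 - \<gamma>)"
  shows "F (x + a *\<^sub>R d) \<le> F x + (\<gamma> * a * max_slope F x d) *\<^sub>R 1"
proof -
  have "0 \<le> K"
    using assms(2) by (rule lipschitz_on_nonneg)
  have "F (x + a *\<^sub>R d) $ j \<le> F x $ j + \<gamma> * a * max_slope F x d" for j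
  proof -
    let ?D = "max_slope F x d"
    have "F (x + a *\<^sub>R d) $ j \<le> F x $ j + nabla F j x \<bullet> (a *\<^sub>R d) + K / 2 * (norm (a *\<^sub>R d))^2"
      by (rule descent_lemma[OF nabla_gderiv[OF assms(1)] assms(2)])
    also have "\<dots> = F x $ j + a * (nabla F j x \<bullet> d) + (K / 2 * a^2) * (norm d)^2"
      by (simp add: power_mult_distrib)
    also have "\<dots> \<le> F x $ j + a * ?D + (K / 2 * a^2) * (- q * ?D)"
      using assms(3,5) \<open>0 \<le> K\<close> nabla_le_max_slope[of F j x d]
      by (intro add_mono mult_left_mono) auto
    also have "\<dots> = F x $ j + a * ?D + (a * - ?D / 2) * (K * q * a)"
      by (simp add: power2_eq_square)
    also have "\<dots> \<le> F x $ j + a * ?D + (a * - ?D / 2) * (2 * (1 - \<gamma>))"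
      using assms(4-6) by (intro add_left_mono mult_left_mono) (auto intro!: mult_nonneg_nonpos)
    also have "\<dots> = F x $ j + \<gamma> * a * ?D"
      by (simp add: field_simps)
    finally show ?thesis .
  qed
  then show ?thesis
    by (simp add: less_eq_vec_def)
qed

text \<open>Either the first trial \<open>\<alpha>\<close> is at most \<open>s\<close> and is
  accepted, or the first trial at or below \<open>s\<close> is \<open>\<delta>\<close> times a trial
  exceeding \<open>s\<close>. The largest accepted trial \<open>a\<close> is no smaller.\<close>

lemma backtracking_step_lower_bound:
  fixes \<alpha> \<delta> s :: real
  assumes "0 < \<alpha>" "0 < \<delta>" "\<delta> < 1" "0 < s"
    and ok: "\<And>h. \<alpha> * \<delta> ^ h \<le> s \<Longrightarrow> Q (\<alpha> * \<delta> ^ h)"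
    and max: "is_maximum {\<alpha> * \<delta> ^ h |h. Q (\<alpha> * \<delta> ^ h)} a"
  shows "min \<alpha> (\<delta> * s) \<le> a"
proof -
  have le: "\<alpha> * \<delta> ^ h \<le> a" if "\<alpha> * \<delta> ^ h \<le> s" for h
    using max ok[OF that] by (auto simp: is_maximum_def)
  have "\<exists>h. \<alpha> * \<delta> ^ h \<le> s"
  proof -
    obtain h where "\<delta> ^ h < s / \<alpha>"
      using real_arch_pow_inv[of "s / \<alpha>" \<delta>] assms by auto
    then show ?thesis
      using \<open>0 < \<alpha>\<close> by (intro exI[of _ h]) (simp add: field_simps)
  qed
  then obtain h where h: "\<alpha> * \<delta> ^ h \<le> s" and least: "\<And>i. i < h \<Longrightarrow> s < \<alpha> * \<delta> ^ i"
    using exists_least_iff[of "\<lambda>h. \<alpha> * \<delta> ^ h \<le> s"] by (auto simp: not_le)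
  show ?thesis
  proof (cases h)
    case 0
    then show ?thesis
      using le[OF h] by simp
  next
    case (Suc i)
    have "\<delta> * s \<le> \<delta> * (\<alpha> * \<delta> ^ i)"
      using least[of i] Suc \<open>0 < \<delta>\<close> by (intro mult_left_mono) auto
    then show ?thesis
      using le[OF h] Suc by (simp add: mult.left_commute)
  qed
qed

text \<open>A direction \<open>vD\<close> passing the test satisfies the bounds with
  \<open>G1\<close> and \<open>G2\<close>, the fallback satisfies them with 1; the minimum and the
  maximum cover both cases.\<close>

lemma refinement_direction_bounds:
  assumes "d = (if max_slope F x vD \<le> - G1 * (norm (steepest_direction F UNIV x))^2 \<and>
      norm vD \<le> G2 * norm (steepest_direction F UNIV x)
    then vD else steepest_direction F UNIV x)"
  shows "max_slope F x d \<le> - min 1 G1 * (norm (steepest_direction F UNIV x))^2"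
    and "norm d \<le> max 1 G2 * norm (steepest_direction F UNIV x)"
proof -
  let ?v = "steepest_direction F UNIV x"
  have scale: "min 1 G1 * (norm ?v)^2 \<le> 1 * (norm ?v)^2" "min 1 G1 * (norm ?v)^2 \<le> G1 * (norm ?v)^2"
    "1 * norm ?v \<le> max 1 G2 * norm ?v" "G2 * norm ?v \<le> max 1 G2 * norm ?v"
    by (intro mult_right_mono; simp)+
  have "max_slope F x ?v \<le> - ((norm ?v)^2)"
    unfolding max_slope_def by (rule Max_slope_steepest_direction) simp
  with assms scale show "max_slope F x d \<le> - min 1 G1 * (norm ?v)^2"
    "norm d \<le> max 1 G2 * norm ?v"
    by (auto split: if_splits)
qed

text \<open>The constant \<open>c\<close> is fixed before \<open>k\<close>, \<open>x\<close>,
  \<open>z\<close> and \<open>j\<close>, so it depends only on the problem and the parameters. This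
  uniformity is what keeps the final constant free of \<epsilon>.\<close>

lemma refinement_sufficient_decrease:
  fixes F :: "real^'n \<Rightarrow> real^'m"
  assumes "F differentiable_on UNIV" "\<And>j. K-lipschitz_on UNIV (nabla F j)" "valid_params P"
  obtains c where "0 < c"
    and "\<And>k x z j. \<lbrakk>sigma P k = 0; refinement P F k x z\<rbrakk>
      \<Longrightarrow> F z $ j \<le> F x $ j - c * (norm (steepest_direction F UNIV x))^2"
proof -
  define c1 where "c1 = min 1 (Gamma1 P)"
  \<comment> \<open>Chosen so that the squared norm bound on \<open>d\<close> becomes
    \<open>q\<close> times the slope bound \<open>c1 * n^2\<close>, as
    \<open>armijo_condition\<close> requires.\<close>
  define q where "q = (max 1 (Gamma2 P))^2 / c1"
  \<comment> \<open>\<open>K + 1\<close> instead of \<open>K\<close> keeps the denominator positive for \<open>K = 0\<close>.\<close>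
  define s where "s = 2 * (1 - gamma P) / ((K + 1) * q)"
  define a0 where "a0 = min (alpha0 P) (delta P * s)"
  have "0 \<le> K"
    using assms(2) by (rule lipschitz_on_nonneg)
  note P = assms(3)[unfolded valid_params_def]
  have "0 < c1"
    using P by (simp add: c1_def)
  then have "0 < q"
    by (simp add: q_def zero_less_divide_iff)
  with \<open>0 \<le> K\<close> P have "0 < s"
    by (simp add: s_def)
  with P have "0 < a0"
    by (simp add: a0_def)
  show ?thesis
  proof
    show "0 < gamma P * a0 * c1"
      using \<open>0 < a0\<close> \<open>0 < c1\<close> P by simp
  next
    fix k x z j
    assume "sigma P k = 0" and ref: "refinement P F k x z"
    define n where "n = norm (steepest_direction F UNIV x)"
    show "F z $ j \<le> F x $ j - gamma P * a0 * c1 * (norm (steepest_direction F UNIV x))^2"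
    proof (cases "theta F UNIV x < 0")
      case True
      then obtain d vD a where
        d: "d = (if max_slope F x vD \<le> - Gamma1 P * (norm (steepest_direction F UNIV x))^2 \<and>
            norm vD \<le> Gamma2 P * norm (steepest_direction F UNIV x)
          then vD else steepest_direction F UNIV x)"
        and a: "is_maximum {alpha0 P * delta P ^ h |h.
            F (x + (alpha0 P * delta P ^ h) *\<^sub>R d)
              \<le> F x + (gamma P * (alpha0 P * delta P ^ h) * max_slope F x d) *\<^sub>R 1} a"
        and z: "z = x + a *\<^sub>R d"
        using ref \<open>sigma P k = 0\<close> unfolding refinement_def by auto
      have slope: "max_slope F x d \<le> - c1 * n^2" and nd: "norm d \<le> max 1 (Gamma2 P) * n"
        using refinement_direction_bounds[OF d] by (auto simp: c1_def n_def)
      have "0 \<le> c1 * n^2"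
        using \<open>0 < c1\<close> by simp
      then have neg: "max_slope F x d \<le> 0"
        using slope by simp
      have "(norm d)^2 \<le> (max 1 (Gamma2 P) * n)^2"
        using nd by (intro power_mono) auto
      also have "\<dots> = q * (c1 * n^2)"
        using \<open>0 < c1\<close> by (simp add: q_def power_mult_distrib)
      also have "\<dots> \<le> q * - max_slope F x d"
        using slope \<open>0 < q\<close> by (intro mult_left_mono) auto
      finally have "(norm d)^2 \<le> - q * max_slope F x d"
        by simp
      moreover have "K * q * t \<le> 2 * (1 - gamma P)" if "0 \<le> t" "t \<le> s" for t
      proof -
        have "K * q * t \<le> ((K + 1) * q) * s"
          using that \<open>0 < q\<close> \<open>0 \<le> K\<close> by (intro mult_mono) auto
        also have "\<dots> = 2 * (1 - gamma P)"
          using \<open>0 < q\<close> \<open>0 \<le> K\<close> by (simp add: s_def)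
        finally show ?thesis .
      qed
      ultimately have "F (x + t *\<^sub>R d) \<le> F x + (gamma P * t * max_slope F x d) *\<^sub>R 1"
        if "0 \<le> t" "t \<le> s" for t
        using that neg by (intro armijo_condition[OF assms(1,2)]) auto
      then have "a0 \<le> a"
        unfolding a0_def using P \<open>0 < s\<close>
        by (intro backtracking_step_lower_bound[OF _ _ _ _ _ a]) auto
      have "F z \<le> F x + (gamma P * a * max_slope F x d) *\<^sub>R 1"
        using a z by (auto simp: is_maximum_def)
      then have "F z $ j \<le> F x $ j + gamma P * a * max_slope F x d"
        by (simp add: less_eq_vec_def)
      also have "gamma P * a * max_slope F x d \<le> gamma P * a * (- c1 * n^2)"
        using slope \<open>a0 \<le> a\<close> \<open>0 < a0\<close> P by (intro mult_left_mono) auto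
      also have "\<dots> \<le> - (gamma P * a0 * (c1 * n^2))"
        using \<open>a0 \<le> a\<close> \<open>0 < a0\<close> P \<open>0 \<le> c1 * n^2\<close>
        by (auto intro!: mult_right_mono mult_left_mono)
      finally show ?thesis
        by (simp add: n_def mult.assoc)
    next
      \<comment> \<open>Here \<open>theta\<close> is nonnegative, so the steepest direction is zero:
        the point stays where it is and the required decrease is zero too.\<close>
      case False
      then have "n^2 \<le> 0"
        using theta_le[OF UNIV_not_empty, of F x] unfolding n_def by linarith
      then have "n = 0"
        by simp
      moreover have "z = x"
        using False ref \<open>sigma P k = 0\<close> by (simp add: refinement_def)
      ultimately show ?thesis
        by (simp add: n_def)
    qed
  qed
qed

section \<open>Counting refinements along the linked sequence\<close>

lemma sweep_refinement:
  assumes "sweep P F k xs S S' R" "(x, z, W) \<in> R"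
  shows "refinement P F k x z"
  using assms by (induction rule: sweep.induct) auto

theorem proposition5p6:
  fixes F :: "real^'n \<Rightarrow> real^'m"
    and L :: "'m \<Rightarrow> real"
    and J :: "'m set"
    and P :: fd_params
    and X0 :: "(real^'n) set"
    and X :: "nat \<Rightarrow> (real^'n) set"
    and R :: "nat \<Rightarrow> 'n processing_log"
    and x :: "nat \<Rightarrow> real^'n"
    and kbar :: nat
  assumes "continuously_differentiable F"
    and "\<And>j. (L j)-lipschitz_on UNIV (nabla F j)"
    and "J \<noteq> {}"
    and "\<And>j. j \<in> J \<Longrightarrow> bdd_below (range (\<lambda>y. F y $ j))"
    and "front_descent_run P F X0 X R"
    and "\<And>k. sigma P k = 0"
    and "refining_linked_sequence X R x"
    and "kbar = (LEAST K. refining_after R x K)"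
  shows "\<exists>C. \<forall>\<epsilon>>0. \<exists>kref::nat.
           real kref \<le> C / \<epsilon>^2 \<and> norm (steepest_direction F UNIV (x (kbar + kref))) \<le> \<epsilon>"
proof -
  have "F differentiable_on UNIV"
    using assms(1) by (simp add: continuously_differentiable_def)
  moreover have "(MAX j. L j)-lipschitz_on UNIV (nabla F j)" for j
    using assms(2) by (rule lipschitz_on_le) simp
  moreover have "valid_params P"
    using assms(5) by (simp add: front_descent_run_def)
  ultimately obtain c where "0 < c"
    and decrease: "\<And>k x z j. \<lbrakk>sigma P k = 0; refinement P F k x z\<rbrakk>
      \<Longrightarrow> F z $ j \<le> F x $ j - c * (norm (steepest_direction F UNIV x))^2"
    using refinement_sufficient_decrease[of F "MAX j. L j" P] by blast
  \<comment> \<open>The decrease holds in every component, so any index of \<open>J\<close> can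
    serve as the potential.\<close>
  obtain j B where B: "\<And>y. B \<le> F y $ j"
    using assms(3,4) unfolding bdd_below_def by fastforce
  have "refining_after R x kbar"
    using assms(7,8) by (auto simp: refining_linked_sequence_def intro: LeastI)
  \<comment> \<open>\<open>refining_after\<close> speaks of indices strictly above
    \<open>kbar\<close>; index \<open>kbar + Suc i\<close> is produced in iteration
    \<open>kbar + i\<close>, so the steps start at \<open>x kbar\<close> itself.\<close>
  have step: "refinement P F (kbar + i) (x (kbar + i)) (x (kbar + Suc i))" for i
  proof -
    obtain z W where "(x (kbar + i), z, W) \<in> R (kbar + i)" "x (kbar + Suc i) = z"
      using \<open>refining_after R x kbar\<close>[unfolded refining_after_def, rule_format, of "kbar + Suc i"]
      by auto
    moreover obtain xs where "sweep P F (kbar + i) xs (X (kbar + i)) (X (Suc (kbar + i))) (R (kbar + i))"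
      using assms(5) unfolding front_descent_run_def by blast
    ultimately show ?thesis
      using sweep_refinement by blast
  qed
  have sum: "F (x (kbar + N)) $ j \<le> F (x kbar) $ j -
      c * (\<Sum>i<N. (norm (steepest_direction F UNIV (x (kbar + i))))^2)" for N
  proof (induction N)
    case (Suc N)
    then show ?case
      using decrease[OF assms(6) step[of N], of j] by (simp add: algebra_simps)
  qed simp
  \<comment> \<open>The total decrease available to component \<open>j\<close> from
    \<open>x kbar\<close> on, in units of \<open>c\<close>; by the telescoped estimate it bounds
    every partial sum of squared norms.\<close>
  define C where "C = (F (x kbar) $ j - B) / c"
  have "0 \<le> C"
    using B[of "x kbar"] \<open>0 < c\<close> by (simp add: C_def)
  have "\<exists>kref::nat. real kref \<le> C / \<epsilon>^2 \<and> norm (steepest_direction F UNIV (x (kbar + kref))) \<le> \<epsilon>"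
    if "0 < \<epsilon>" for \<epsilon>
  proof (rule ccontr)
    assume "\<not> ?thesis"
    then have large: "\<epsilon> < norm (steepest_direction F UNIV (x (kbar + i)))" if "real i \<le> C / \<epsilon>^2" for i
      using that by (meson not_le)
    \<comment> \<open>The indices below \<open>N\<close> are exactly those with
      \<open>real i \<le> C / \<epsilon>^2\<close>, zero included. Each contributes more than
      \<open>\<epsilon>^2\<close> to a sum bounded by \<open>C\<close>, so \<open>N\<close> itself
      would satisfy this bound, although it is the first integer beyond it.\<close>
    define N where "N = Suc (nat \<lfloor>C / \<epsilon>^2\<rfloor>)"
    have "real i \<le> C / \<epsilon>^2" if "i < N" for i
      using that \<open>0 \<le> C\<close> by (simp add: N_def less_Suc_eq_le le_nat_iff le_floor_iff)
    then have "(\<Sum>i<N. \<epsilon>^2) \<le> (\<Sum>i<N. (norm (steepest_direction F UNIV (x (kbar + i))))^2)"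
      using large \<open>0 < \<epsilon>\<close> by (intro sum_mono power_mono) (auto simp: less_imp_le)
    also have "\<dots> \<le> C"
      using sum[of N] B[of "x (kbar + N)"] \<open>0 < c\<close> by (simp add: C_def field_simps)
    finally have "real N \<le> C / \<epsilon>^2"
      using \<open>0 < \<epsilon>\<close> by (simp add: field_simps)
    moreover have "C / \<epsilon>^2 < real N"
      unfolding N_def by linarith
    ultimately show False
      by simp
  qed
  then show ?thesis
    by blast
qed

end
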